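(* There exist positive integers $a,b,c,d$ with $b>1$, $d>1$ and $a(b-1)=c(d-1)$ such that the permutation $f=P(a,b,c,d)$ of $\mathbb{N}_0$ has infinitely many (pairwise distinct) divergent trajectories.
   Context: $\mathbb{N}_0=\{0,1,2,\dots\}$. With $N=a(b-1)=c(d-1)$, let $r_1<\dots<r_N$ be the elements of $\{1,\dots,ab-1\}$ not divisible by $b$, and $s_1<\dots<s_N$ the elements of $\{1,\dots,cd-1\}$ not divisible by $d$. $P(a,b,c,d):\mathbb{N}_0\to\mathbb{N}_0$ is defined for $n\in\mathbb{N}_0$ by $f(bn)=dn$ and $f(abn+r_i)=cdn+s_i$, $i=1,\dots,N$; it is a bijection. For $x\in\mathbb{N}_0$, the trajectory of $x$ is the set $\{f^k(x):k\in\mathbb{Z}\}$; it is a divergent trajectory if this set is infinite (equivalently, $f^k(x)\neq x$ for all $k\ge 1$). Two divergent trajectories are distinct if they are different sets. *)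

theory Defs
  imports Main
begin

text \<open>
  \<open>nonmultiples q p\<close> is the increasing list of the elements of \<open>{1, ..., q p - 1}\<close> that are
  not divisible by \<open>p\<close>. Its entries are indexed from 0, so that
  \<open>r\<^sub>i = nonmultiples a b ! (i - 1)\<close> and \<open>s\<^sub>i = nonmultiples c d ! (i - 1)\<close>.
\<close>

definition nonmultiples :: "nat \<Rightarrow> nat \<Rightarrow> nat list" where
  "nonmultiples q p = sorted_list_of_set {x \<in> {1..q * p - 1}. \<not> p dvd x}"

definition is_perm_P :: "nat \<Rightarrow> nat \<Rightarrow> nat \<Rightarrow> nat \<Rightarrow> (nat \<Rightarrow> nat) \<Rightarrow> bool" where
  "is_perm_P a b c d f \<longleftrightarrow>
     (\<forall>n. f (b * n) = d * n) \<and>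
     (\<forall>n. \<forall>i < a * (b - 1).
        f (a * b * n + nonmultiples a b ! i) = c * d * n + nonmultiples c d ! i)"

text \<open>
  The description is meaningful only for \<open>a, c \<ge> 1\<close>, \<open>b, d \<ge> 2\<close> and \<open>a (b - 1) = c (d - 1)\<close>;
  existence, uniqueness and bijectivity in that case are proved below.
\<close>

definition perm_P :: "nat \<Rightarrow> nat \<Rightarrow> nat \<Rightarrow> nat \<Rightarrow> nat \<Rightarrow> nat" where
  "perm_P a b c d = (THE f. is_perm_P a b c d f)"

text \<open>Integer iterates; intended for bijective \<open>f\<close>.\<close>

definition iterate :: "('a \<Rightarrow> 'a) \<Rightarrow> int \<Rightarrow> 'a \<Rightarrow> 'a" where
  "iterate f k = (if k \<ge> 0 then f ^^ nat k else inv f ^^ nat (- k))"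

definition trajectory :: "('a \<Rightarrow> 'a) \<Rightarrow> 'a \<Rightarrow> 'a set" where
  "trajectory f x = {iterate f k x | k. True}"

definition divergent_trajectories :: "('a \<Rightarrow> 'a) \<Rightarrow> 'a set set" where
  "divergent_trajectories f = {T. (\<exists>x. T = trajectory f x) \<and> infinite T}"


lemma set_nonmultiples: "set (nonmultiples q p) = {x \<in> {1..q * p - 1}. \<not> p dvd x}"
  unfolding nonmultiples_def by (subst set_sorted_list_of_set) auto

lemma distinct_nonmultiples: "distinct (nonmultiples q p)"
  unfolding nonmultiples_def by simp

lemma length_nonmultiples:
  assumes "0 < q" "1 < p"
  shows "length (nonmultiples q p) = q * (p - 1)"
proof -
  have eq: "{x \<in> {1..q * p - 1}. \<not> p dvd x} = {..<q * p} - (\<lambda>k. p * k) ` {..<q}"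
  proof (intro set_eqI iffI)
    fix x assume "x \<in> {x \<in> {1..q * p - 1}. \<not> p dvd x}"
    then show "x \<in> {..<q * p} - (\<lambda>k. p * k) ` {..<q}" by auto
  next
    fix x assume x: "x \<in> {..<q * p} - (\<lambda>k. p * k) ` {..<q}"
    have "\<not> p dvd x"
    proof
      assume "p dvd x"
      then obtain k where k: "x = p * k" by (elim dvdE)
      with x have "p * k < p * q" by (simp add: mult.commute)
      then have "k < q" by simp
      with k x show False by auto
    qed
    moreover from this have "x \<noteq> 0" by (intro notI) simp
    ultimately show "x \<in> {x \<in> {1..q * p - 1}. \<not> p dvd x}" using x by auto
  qed
  have "inj_on (\<lambda>k. p * k) {..<q}" using assms by (auto intro: inj_onI)
  then have c: "card ((\<lambda>k. p * k) ` {..<q}) = q" by (simp add: card_image)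
  have sub: "(\<lambda>k. p * k) ` {..<q} \<subseteq> {..<q * p}"
    using assms by (auto simp: mult.commute)
  have "card {x \<in> {1..q * p - 1}. \<not> p dvd x} = q * p - q"
    unfolding eq by (subst card_Diff_subset) (use sub c in auto)
  then show ?thesis
    unfolding nonmultiples_def by (simp add: right_diff_distrib')
qed

lemma nonmultiple_decomp:
  fixes q p m :: nat
  assumes "0 < q" "1 < p" "\<not> p dvd m"
  shows "\<exists>n i. i < q * (p - 1) \<and> m = q * p * n + nonmultiples q p ! i"
proof -
  let ?r = "m mod (q * p)"
  have "\<not> p dvd ?r" using assms(3) by (simp add: dvd_mod_iff)
  moreover from this have "?r \<noteq> 0" by (intro notI) simp
  moreover have "?r < q * p" using assms by simp
  ultimately have "?r \<in> set (nonmultiples q p)"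
    unfolding set_nonmultiples by auto
  then obtain i where "i < q * (p - 1)" "nonmultiples q p ! i = ?r"
    using length_nonmultiples[OF assms(1,2)] by (auto simp: in_set_conv_nth)
  moreover have "m = q * p * (m div (q * p)) + ?r" by simp
  ultimately show ?thesis by metis
qed

lemma nonmultiples_nth:
  assumes "0 < q" "1 < p" "i < q * (p - 1)"
  shows "nonmultiples q p ! i < q * p" "\<not> p dvd q * p * n + nonmultiples q p ! i"
proof -
  have "nonmultiples q p ! i \<in> set (nonmultiples q p)"
    using assms by (simp add: length_nonmultiples)
  then have *: "nonmultiples q p ! i \<in> {x \<in> {1..q * p - 1}. \<not> p dvd x}"
    by (simp only: set_nonmultiples)
  have "0 < q * p" using assms by simp
  with * show "nonmultiples q p ! i < q * p" by auto
  from * show "\<not> p dvd q * p * n + nonmultiples q p ! i"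
    by (simp add: dvd_add_right_iff)
qed

lemma nonmultiple_decomp_unique:
  assumes "0 < q" "1 < p" "i < q * (p - 1)" "j < q * (p - 1)"
    and eq: "q * p * n + nonmultiples q p ! i = q * p * m + nonmultiples q p ! j"
  shows "n = m" "i = j"
proof -
  note l = nonmultiples_nth(1)[OF assms(1,2,3)] nonmultiples_nth(1)[OF assms(1,2,4)]
  have "(q * p * n + nonmultiples q p ! i) div (q * p) = n"
    using l(1) by (intro div_nat_eqI) (auto simp: algebra_simps)
  moreover have "(q * p * m + nonmultiples q p ! j) div (q * p) = m"
    using l(2) by (intro div_nat_eqI) (auto simp: algebra_simps)
  ultimately show "n = m" using eq by simp
  with eq have "nonmultiples q p ! i = nonmultiples q p ! j" by simp
  then show "i = j"
    using assms distinct_nonmultiples[of q p] by (simp add: nth_eq_iff_index_eq length_nonmultiples)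
qed

lemma is_perm_P_unique:
  assumes "0 < a" "1 < b" "is_perm_P a b c d f" "is_perm_P a b c d g"
  shows "f = g"
proof
  fix m
  show "f m = g m"
  proof (cases "b dvd m")
    case True
    then obtain n where "m = b * n" by (elim dvdE)
    then show ?thesis using assms(3,4) unfolding is_perm_P_def by metis
  next
    case False
    then obtain n i where "i < a * (b - 1)" "m = a * b * n + nonmultiples a b ! i"
      using nonmultiple_decomp[OF assms(1,2)] by blast
    then show ?thesis using assms(3,4) unfolding is_perm_P_def by metis
  qed
qed

lemma is_perm_P_exists:
  assumes "0 < a" "1 < b"
  shows "\<exists>f. is_perm_P a b c d f"
proof -
  define R where "R m y \<longleftrightarrow> (\<exists>n. m = b * n \<and> y = d * n) \<or>
    (\<exists>n i. i < a * (b - 1) \<and> m = a * b * n + nonmultiples a b ! i \<and>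
       y = c * d * n + nonmultiples c d ! i)" for m y
  define f where "f m = (THE y. R m y)" for m
  have "f (b * n) = d * n" for n
    unfolding f_def
  proof (rule the_equality)
    show "R (b * n) (d * n)" by (auto simp: R_def)
    fix y assume "R (b * n) y"
    then consider k where "b * n = b * k" "y = d * k"
      | k i where "i < a * (b - 1)" "b * n = a * b * k + nonmultiples a b ! i"
      unfolding R_def by blast
    then show "y = d * n"
    proof cases
      case 1 then show ?thesis using assms by simp
    next
      case 2
      then show ?thesis using nonmultiples_nth(2)[OF assms 2(1), of k] by (metis dvd_triv_left)
    qed
  qed
  moreover have "f (a * b * n + nonmultiples a b ! i) = c * d * n + nonmultiples c d ! i"
    if i: "i < a * (b - 1)" for n i
    unfolding f_def
  proof (rule the_equality)
    show "R (a * b * n + nonmultiples a b ! i) (c * d * n + nonmultiples c d ! i)"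
      using i by (auto simp: R_def)
    fix y assume "R (a * b * n + nonmultiples a b ! i) y"
    then consider k where "a * b * n + nonmultiples a b ! i = b * k"
      | k j where "j < a * (b - 1)"
          "a * b * n + nonmultiples a b ! i = a * b * k + nonmultiples a b ! j"
          "y = c * d * k + nonmultiples c d ! j"
      unfolding R_def by blast
    then show "y = c * d * n + nonmultiples c d ! i"
    proof cases
      case 1
      then show ?thesis using nonmultiples_nth(2)[OF assms i, of n] by (metis dvd_triv_left)
    next
      case 2
      then show ?thesis using nonmultiple_decomp_unique[OF assms i 2(1,2)] by simp
    qed
  qed
  ultimately show ?thesis unfolding is_perm_P_def by blast
qed

lemma is_perm_P_perm_P:
  assumes "0 < a" "1 < b"
  shows "is_perm_P a b c d (perm_P a b c d)"
proof -
  obtain f where f: "is_perm_P a b c d f" using is_perm_P_exists[OF assms] by blast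
  show ?thesis
    unfolding perm_P_def by (rule theI[of "is_perm_P a b c d", OF f]) (rule is_perm_P_unique[OF assms _ f])
qed

lemma bij_perm_P:
  assumes "0 < a" "1 < b" "0 < c" "1 < d" "a * (b - 1) = c * (d - 1)"
  shows "bij (perm_P a b c d)"
proof -
  have inverse: "perm_P c' d' a' b' (perm_P a' b' c' d' m) = m"
    if "0 < a'" "1 < b'" "0 < c'" "1 < d'" "a' * (b' - 1) = c' * (d' - 1)" for a' b' c' d' m
  proof -
    note pos = that
    have P: "is_perm_P a' b' c' d' (perm_P a' b' c' d')"
      and Q: "is_perm_P c' d' a' b' (perm_P c' d' a' b')"
      using that by (auto intro: is_perm_P_perm_P)
    show ?thesis
    proof (cases "b' dvd m")
      case True
      then obtain n where "m = b' * n" by (elim dvdE)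
      then show ?thesis using P Q unfolding is_perm_P_def by metis
    next
      case False
      then obtain n i where i: "i < a' * (b' - 1)" and m: "m = a' * b' * n + nonmultiples a' b' ! i"
        using nonmultiple_decomp[OF pos(1,2)] by blast
      have "perm_P a' b' c' d' m = c' * d' * n + nonmultiples c' d' ! i"
        using P i unfolding m is_perm_P_def by blast
      moreover have "perm_P c' d' a' b' (c' * d' * n + nonmultiples c' d' ! i) = m"
        using Q i pos(5) unfolding m is_perm_P_def by simp
      ultimately show ?thesis by simp
    qed
  qed
  show ?thesis
    by (rule o_bij[where g = "perm_P c d a b"])
      (use inverse[of a b c d] inverse[of c d a b] assms in \<open>auto simp: fun_eq_iff\<close>)
qed

end

(*
  If b = 2 and d = 4, then f (2n) = 4n: an even x has the iterates 2^k x, so every positive even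
  number has a divergent trajectory. Numbers congruent to 2 modulo 4 lie on pairwise distinct
  trajectories, since all proper forward iterates of such a number are divisible by 4.
*)
theory Submission
  imports Defs
begin

text \<open>Doubling preserves evenness, so the rule for \<open>f\<close> applies again at every
  step.\<close>

lemma funpow_even_doubling:
  fixes f :: "nat \<Rightarrow> nat"
  assumes "\<And>n. f (2 * n) = 4 * n" "even x"
  shows "(f ^^ k) x = 2 ^ k * x"
proof (induction k)
  case (Suc k)
  obtain y where "x = 2 * y" using assms(2) by (elim evenE)
  with Suc assms(1)[of "2 ^ k * y"] show ?case by (simp add: mult.left_commute)
qed simp

lemma funpow_in_trajectory: "(f ^^ k) x \<in> trajectory f x"
  unfolding trajectory_def iterate_def by (auto intro!: exI[of _ "int k"])

text \<open>Removes integer iterates: a backward iterate from \<open>x\<close> to \<open>y\<close>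
  is read as a forward iterate from \<open>y\<close> to \<open>x\<close>, where the doubling formula
  can be used.\<close>

lemma trajectory_cases:
  assumes "bij f" "y \<in> trajectory f x"
  obtains k where "y = (f ^^ k) x" | k where "x = (f ^^ k) y"
proof -
  obtain k where k: "y = iterate f k x"
    using assms(2) by (auto simp: trajectory_def)
  show thesis
  proof (cases "k \<ge> 0")
    case True
    with k that(1) show thesis by (simp add: iterate_def)
  next
    case False
    have "surj (f ^^ nat (- k))" using assms(1) by (simp add: bij_is_surj bij_fn)
    with False k have "x = (f ^^ nat (- k)) y"
      using assms(1) by (simp add: iterate_def inv_fn[symmetric] surj_f_inv_f)
    with that(2) show thesis .
  qed
qed

lemma infinite_trajectory_doubling:
  fixes f :: "nat \<Rightarrow> nat"
  assumes "\<And>n. f (2 * n) = 4 * n" "even x" "0 < x"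
  shows "infinite (trajectory f x)"
proof (rule infinite_super)
  show "range (\<lambda>k. 2 ^ k * x) \<subseteq> trajectory f x"
    using funpow_in_trajectory[of _ f x] funpow_even_doubling[of f, OF assms(1,2)] by auto
  \<comment> \<open>Positivity of \<open>x\<close> matters here: 0 is a fixed point of
    \<open>f\<close>.\<close>
  have "inj (\<lambda>k. 2 ^ k * x)" using assms(3) by (intro injI) simp
  then show "infinite (range (\<lambda>k. 2 ^ k * x))" by (simp add: finite_image_iff)
qed

lemma inj_trajectory_doubling:
  fixes f :: "nat \<Rightarrow> nat"
  assumes "bij f" "\<And>n. f (2 * n) = 4 * n"
  shows "inj (\<lambda>j. trajectory f (4 * j + 2))"
proof (rule injI)
  fix i j
  assume "trajectory f (4 * i + 2) = trajectory f (4 * j + 2)"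
  then have mem: "4 * j + 2 \<in> trajectory f (4 * i + 2)"
    using funpow_in_trajectory[of 0 f "4 * j + 2"] by simp
  \<comment> \<open>Kept general in \<open>m\<close> and \<open>n\<close> so that it serves both
    directions: \<open>j\<close> reached from \<open>i\<close>, and \<open>i\<close> reached from
    \<open>j\<close>.\<close>
  have eq: "m = n" if "4 * m + 2 = (f ^^ k) (4 * n + 2)" for m n k
  proof -
    from that have *: "4 * m + 2 = 2 ^ k * (4 * n + 2)"
      by (simp add: funpow_even_doubling[of f, OF assms(2)])
    show ?thesis
    proof (cases k)
      case 0
      with * show ?thesis by simp
    next
      case (Suc l)
      with * have "2 * m + 1 = 2 * (2 ^ l * (2 * n + 1))" by (simp add: algebra_simps)
      \<comment> \<open>An odd number would equal an even one, so \<open>k\<close> cannot be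
        positive.\<close>
      then show ?thesis by presburger
    qed
  qed
  from assms(1) mem show "i = j" by (cases rule: trajectory_cases) (blast dest: eq)+
qed

theorem mainTheorem3:
  shows "\<exists>a b c d :: nat. 0 < a \<and> 1 < b \<and> 0 < c \<and> 1 < d \<and> a * (b - 1) = c * (d - 1) \<and>
           infinite (divergent_trajectories (perm_P a b c d))"
proof -
  \<comment> \<open>With \<open>b = 2\<close> and \<open>d = 4\<close> the balance condition reads
    \<open>a = 3 * c\<close>; \<open>c = 1\<close> is the smallest choice.\<close>
  let ?f = "perm_P 3 2 1 4"
  have "is_perm_P 3 2 1 4 ?f" by (rule is_perm_P_perm_P) simp_all
  then have dbl: "?f (2 * n) = 4 * n" for n by (simp add: is_perm_P_def)
  have "bij ?f" by (rule bij_perm_P) simp_all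
  then have "inj (\<lambda>j. trajectory ?f (4 * j + 2))" by (rule inj_trajectory_doubling[OF _ dbl])
  then have "infinite (range (\<lambda>j. trajectory ?f (4 * j + 2)))"
    using finite_imageD infinite_UNIV_nat by blast
  moreover have "range (\<lambda>j. trajectory ?f (4 * j + 2)) \<subseteq> divergent_trajectories ?f"
    using infinite_trajectory_doubling[of ?f, OF dbl] by (auto simp: divergent_trajectories_def)
  ultimately have "infinite (divergent_trajectories ?f)" by (rule infinite_super[rotated])
  then show ?thesis by (intro exI[of _ 3] exI[of _ 2] exI[of _ 1] exI[of _ 4]) simp
qed

end
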